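(* (1) A function $f$ is a $G$-extremal function belonging to $\mathrm{BMO}_{\mathrm{na}}\cap H^\infty$ if and only if $f=cI$ for some $c\in\mathbb C$ and some inner function $I$ that has a zero in $\mathbb D$. (2) A function $f$ is a $G$-extremal function belonging to $QA$ if and only if $f=cB$ for some $c\in\mathbb C$ and some nonconstant finite Blaschke product $B$.
   Context: $\mathbb D=\{z\in\mathbb C:|z|<1\}$, $\mathbb T=\partial\mathbb D$, $m$ is normalized arc length measure on $\mathbb T$, $L^p=L^p(\mathbb T,m)$ (complex-valued functions). For $f\in L^1$, the Poisson integral is $\mathcal Pf(z)=\int_{\mathbb T}f(\zeta)\frac{1-|z|^2}{|\zeta-z|^2}\,dm(\zeta)$, $z\in\mathbb D$. $H^p$ is the set of $f\in L^p$ with $\mathcal Pf$ analytic on $\mathbb D$; such $f$ is identified with its analytic extension $\mathcal Pf$. For $f\in L^2$ put $\Phi_f(z)=\mathcal P(|f|^2)(z)-|\mathcal Pf(z)|^2$, $z\in\mathbb D$, and $\|f\|_G=\sup_{z\in\mathbb D}\Phi_f(z)^{1/2}$ (the Garsia norm). $\mathrm{BMO}$ is the set of $f\in L^2$ with $\|f\|_G<\infty$; $\mathrm{BMO}_{\mathrm{na}}$ is the set of $f\in\mathrm{BMO}$ for which there is a point $z_0\in\mathbb D$ with $\|f\|_G^2=\Phi_f(z_0)$; $\mathrm{VMO}$ is the set of $f\in\mathrm{BMO}$ with $\Phi_f(z)\to0$ as $|z|\to1^-$; $QA=\mathrm{VMO}\cap H^\infty$. A function $f\in L^\infty$ is called $G$-extremal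 if $\|f\|_G=\|f\|_\infty$. Functions are treated as individual functions, not modulo constants. An inner function is a function $I\in H^\infty$ with $|I|=1$ a.e. on $\mathbb T$. A finite Blaschke product is a finite product of the form $\prod_j\frac{|z_j|}{z_j}\frac{z_j-z}{1-\bar z_jz}$ with $z_j\in\mathbb D$ (with $|z_j|/z_j:=-1$ if $z_j=0$). *)

theory Defs
  imports "HOL-Complex_Analysis.Complex_Analysis" "HOL-Probability.Essential_Supremum"
begin

text \<open>Normalized arc length on the unit circle (with space \<open>sphere 0 1\<close>), completed, so
  measurability is Lebesgue measurability and is invariant under changes on null sets.\<close>

definition circle_measure :: "complex measure" where
  "circle_measure =
     completion (distr (uniform_measure lborel {0..<2 * pi}) (restrict_space borel (sphere 0 1)) cis)"

text \<open>An element of \<open>L\<^sup>p\<close> is represented by a function on the plane; only its values on the circle,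
  up to null sets, matter.\<close>

definition L2 :: "(complex \<Rightarrow> complex) set" where
  "L2 = {f \<in> borel_measurable circle_measure. integrable circle_measure (\<lambda>\<zeta>. (norm (f \<zeta>))\<^sup>2)}"

definition Linf_norm :: "(complex \<Rightarrow> complex) \<Rightarrow> ereal" where
  "Linf_norm f = esssup circle_measure (\<lambda>\<zeta>. ereal (norm (f \<zeta>)))"

definition Linf :: "(complex \<Rightarrow> complex) set" where
  "Linf = {f \<in> borel_measurable circle_measure. Linf_norm f < \<infinity>}"

definition poisson :: "(complex \<Rightarrow> 'a::{banach, second_countable_topology}) \<Rightarrow> complex \<Rightarrow> 'a" where
  "poisson f z = (LINT \<zeta>|circle_measure. ((1 - (norm z)\<^sup>2) / (norm (\<zeta> - z))\<^sup>2) *\<^sub>R f \<zeta>)"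

definition Hinf :: "(complex \<Rightarrow> complex) set" where
  "Hinf = {f \<in> Linf. poisson f analytic_on ball 0 1}"

definition garsia_Phi :: "(complex \<Rightarrow> complex) \<Rightarrow> complex \<Rightarrow> real" where
  "garsia_Phi f z = poisson (\<lambda>\<zeta>. (norm (f \<zeta>))\<^sup>2) z - (norm (poisson f z))\<^sup>2"

definition garsia_norm :: "(complex \<Rightarrow> complex) \<Rightarrow> ereal" where
  "garsia_norm f = (SUP z\<in>ball 0 1. ereal (sqrt (garsia_Phi f z)))"

definition BMO :: "(complex \<Rightarrow> complex) set" where
  "BMO = {f \<in> L2. garsia_norm f < \<infinity>}"

definition BMO_na :: "(complex \<Rightarrow> complex) set" where
  "BMO_na = {f \<in> BMO. \<exists>z\<^sub>0\<in>ball 0 1. (garsia_norm f)\<^sup>2 = ereal (garsia_Phi f z\<^sub>0)}"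

text \<open>The filter below is \<open>|z| \<rightarrow> 1\<^sup>-\<close>.\<close>

definition VMO :: "(complex \<Rightarrow> complex) set" where
  "VMO = {f \<in> BMO. (garsia_Phi f \<longlongrightarrow> 0) (filtercomap norm (at_left 1))}"

definition QA :: "(complex \<Rightarrow> complex) set" where
  "QA = VMO \<inter> Hinf"

definition G_extremal :: "(complex \<Rightarrow> complex) \<Rightarrow> bool" where
  "G_extremal f \<longleftrightarrow> f \<in> Linf \<and> garsia_norm f = Linf_norm f"

definition inner_function :: "(complex \<Rightarrow> complex) \<Rightarrow> bool" where
  "inner_function I \<longleftrightarrow> I \<in> Hinf \<and> (AE \<zeta> in circle_measure. norm (I \<zeta>) = 1)"

definition blaschke_factor :: "complex \<Rightarrow> complex \<Rightarrow> complex" where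
  "blaschke_factor a z =
     (if a = 0 then -1 else of_real (norm a) / a) * ((a - z) / (1 - cnj a * z))"

definition finite_blaschke_product :: "(complex \<Rightarrow> complex) \<Rightarrow> bool" where
  "finite_blaschke_product B \<longleftrightarrow>
     (\<exists>(n::nat) a. (\<forall>j<n. a j \<in> ball 0 1) \<and> (\<forall>z\<in>cball 0 1. B z = (\<Prod>j<n. blaschke_factor (a j) z)))"

end

theory Submission
  imports Defs "HOL-Probability.Probability_Measure"
begin

text \<open>For bounded \<open>f\<close> with \<open>M = \<parallel>f\<parallel>\<^sub>\<infinity>\<close> both terms of \<open>\<Phi>\<^sub>f = P(|f|\<^sup>2) - |Pf|\<^sup>2\<close> push it below \<open>M\<^sup>2\<close>: the
first is an average of \<open>|f|\<^sup>2\<close> against a strictly positive kernel of mass one, and the second is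
subtracted. So \<open>\<Phi>\<^sub>f(z\<^sub>0) = M\<^sup>2\<close> at some point of the disc means exactly that \<open>|f| = M\<close> almost
everywhere and \<open>Pf(z\<^sub>0) = 0\<close> (\<open>garsia_Phi_maximal_imp\<close>); a \<open>G\<close>-extremal function whose Garsia norm
is attained and whose Poisson integral is analytic is therefore \<open>M\<close> times an inner function with a
zero in the disc. Conversely \<open>|f| = M\<close> gives \<open>\<Phi>\<^sub>f = M\<^sup>2 - |Pf|\<^sup>2\<close>, and a zero of \<open>Pf\<close> attains the
bound.

For the second equivalence, \<open>\<Phi>\<^sub>f\<close> is continuous on the disc, so if it vanishes at the boundary its
supremum is attained as soon as it is positive (\<open>bounded_VMO_attains_garsia_norm\<close>); if the supremum is zero,
extremality makes \<open>f\<close> vanish almost everywhere. In the positive case \<open>f = cI\<close>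
with \<open>I\<close> inner, and now \<open>\<Phi>\<^sub>f = |c|\<^sup>2(1 - |PI|\<^sup>2) \<longlongrightarrow> 0\<close> says \<open>|PI| \<longlongrightarrow> 1\<close> at the boundary. An analytic
function with this property has only finitely many zeros; dividing them out by Blaschke factors
leaves a zero-free function to which the maximum principle applies together with its reciprocal, so
it is a constant (\<open>unimodular_boundary_imp_finite_blaschke_product\<close>). Thus \<open>PI = dB\<close> on the disc.

It remains to pass from \<open>PI = dB\<close> on the disc to \<open>I = dB\<close> almost everywhere on the circle.
Both functions are unimodular there, so it is enough to know
\<open>\<integral> I \<cdot> cnj (dB) dm = 1\<close>, since then \<open>\<integral> |I - dB|\<^sup>2 dm = 0\<close>. This inner product can be computed from
the values of \<open>PI\<close> inside the disc because the operator \<open>u \<mapsto> Pu(r \<cdot>)\<close> is symmetric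
(\<open>poisson_dilation_self_adjoint\<close>, \<open>boundary_values_unique\<close>).\<close>

section \<open>Normalized arc length on the circle\<close>

text \<open>The two preimages of a measurable set differ by a null set, and completeness makes every subset
of a null set measurable.\<close>

lemma (in complete_measure) measurable_AE_cong:
  assumes f: "f \<in> M \<rightarrow>\<^sub>M N" and ae: "AE x in M. f x = g x"
    and g: "g \<in> space M \<rightarrow> space N"
  shows "g \<in> M \<rightarrow>\<^sub>M N"
proof (rule measurableI)
  show "g x \<in> space N" if "x \<in> space M" for x using g that by auto
  fix A assume A: "A \<in> sets N"
  show "g -` A \<inter> space M \<in> sets M"
  proof (rule in_sets_AE)
    show "f -` A \<inter> space M \<in> sets M" using f A by (rule measurable_sets)
    show "AE x in M. x \<in> f -` A \<inter> space M \<longleftrightarrow> x \<in> g -` A \<inter> space M"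
      using ae by eventually_elim auto
  qed auto
qed

lemma cis_measurable_circle: "cis \<in> uniform_measure lborel {0..<2 * pi} \<rightarrow>\<^sub>M restrict_space borel (sphere 0 1)"
proof -
  have "cis \<in> borel \<rightarrow>\<^sub>M borel"
    by (intro borel_measurable_continuous_onI continuous_intros)
  then show ?thesis
    by (intro measurable_restrict_space2) (auto simp: uniform_measure_def)
qed

lemma space_circle [simp]: "space circle_measure = sphere 0 1"
  by (simp add: circle_measure_def space_restrict_space)

lemma prob_space_circle: "prob_space circle_measure"
  unfolding circle_measure_def
proof (intro prob_space.prob_space_completion prob_space.prob_space_distr cis_measurable_circle)
  show "prob_space (uniform_measure lborel {0..<2 * pi})"
    by (rule prob_space_uniform_measure) (auto simp: emeasure_lborel_Ico)
qed

interpretation circle: prob_space circle_measure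
  by (rule prob_space_circle)

lemma complete_circle: "complete_measure circle_measure"
  unfolding circle_measure_def by (rule completion.complete_measure_axioms)

lemma measurable_circle_AE_cong:
  fixes f g :: "complex \<Rightarrow> 'a::topological_space"
  assumes "f \<in> borel_measurable circle_measure" "AE \<zeta> in circle_measure. f \<zeta> = g \<zeta>"
  shows "g \<in> borel_measurable circle_measure"
  using complete_measure.measurable_AE_cong[OF complete_circle assms] by simp

lemma measurable_circle_borel:
  assumes "f \<in> borel_measurable (restrict_space borel (sphere 0 1))"
  shows "f \<in> borel_measurable circle_measure"
  unfolding circle_measure_def using assms by (intro measurable_completion) simp

lemma continuous_measurable_circle:
  fixes f :: "complex \<Rightarrow> 'a::topological_space"
  assumes "continuous_on (sphere 0 1) f"
  shows "f \<in> borel_measurable circle_measure"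
  using assms by (intro measurable_circle_borel borel_measurable_continuous_on_restrict)

text \<open>On the unit circle \<open>dw / w = \<i> dt\<close>. Through this lemma Cauchy's theorems become statements about
integrals against \<open>dm\<close>.\<close>

lemma integral_circle_eq_contour:
  fixes h :: "complex \<Rightarrow> complex"
  assumes h: "continuous_on (sphere 0 1) h"
    and I: "((\<lambda>w. h w / w) has_contour_integral I) (circlepath 0 1)"
  shows "(LINT \<zeta>|circle_measure. h \<zeta>) = I / (2 * pi * \<i>)"
proof -
  have hm: "h \<in> borel_measurable (restrict_space borel (sphere 0 1))"
    by (intro borel_measurable_continuous_on_restrict h)
  have hc: "continuous_on {0..2*pi} (\<lambda>t. h (cis t))"
    by (rule continuous_on_compose2[OF h]) (auto intro!: continuous_intros)
  have hcm: "(\<lambda>t. h (cis t)) \<in> borel_measurable borel"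
    by (intro borel_measurable_continuous_onI continuous_on_compose2[OF h] continuous_intros) auto
  have "(LINT \<zeta>|circle_measure. h \<zeta>) = (LINT t|uniform_measure lborel {0..<2 * pi}. h (cis t))"
    unfolding circle_measure_def using hm
    by (subst integral_completion, simp) (simp add: integral_distr[OF cis_measurable_circle])
  also have "uniform_measure lborel {0..<2 * pi} =
      density lborel (\<lambda>t. ennreal (indicator {0..<2*pi} t / (2 * pi)))"
    unfolding uniform_measure_def
    by (intro arg_cong[where f="density lborel"] ext)
       (auto simp: emeasure_lborel_Ico indicator_def divide_ennreal[symmetric] ennreal_1[symmetric] simp del: ennreal_1)
  also have "(LINT t|\<dots>. h (cis t)) = (LINT t|lborel. (indicator {0..<2*pi} t / (2 * pi)) *\<^sub>R h (cis t))"
    using hcm by (intro integral_density) auto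
  also have "\<dots> = (LINT t|lborel. (1 / (2 * pi)) *\<^sub>R (indicator {0..<2*pi} t *\<^sub>R h (cis t)))"
    by (simp add: field_simps)
  also have "\<dots> = (1 / (2 * pi)) *\<^sub>R (LINT t:{0..<2*pi}|lborel. h (cis t))"
    unfolding set_lebesgue_integral_def by (rule integral_scaleR_right)
  also have "(LINT t:{0..<2*pi}|lborel. h (cis t)) = integral {0..<2*pi} (\<lambda>t. h (cis t))"
  proof (rule set_borel_integral_eq_integral(2))
    have "set_integrable lborel {0..2*pi} (\<lambda>t. h (cis t))"
      unfolding set_integrable_def by (rule borel_integrable_compact[OF _ hc]) simp
    then show "set_integrable lborel {0..<2*pi} (\<lambda>t. h (cis t))"
      by (rule set_integrable_subset) auto
  qed
  also have "\<dots> = integral {0..2*pi} (\<lambda>t. h (cis t))"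
  proof (rule integral_spike_set)
    show "negligible {x \<in> {0..<2*pi} - {0..2*pi}. h (cis x) \<noteq> 0}"
      by (rule negligible_subset[of "{}"]) auto
    show "negligible {x \<in> {0..2*pi} - {0..<2*pi}. h (cis x) \<noteq> 0}"
      by (rule negligible_subset[of "{2*pi}"]) auto
  qed
  also have "\<dots> = I / \<i>"
  proof -
    have "((\<lambda>t. h (0 + 1 * cis t) / (0 + 1 * cis t) * 1 * \<i> * cis t) has_integral I) {0..2*pi}"
      using I unfolding circlepath_def
      by (subst (asm) has_contour_integral_part_circlepath_iff) auto
    then have "((\<lambda>t. h (cis t) * \<i>) has_integral I) {0..2*pi}"
      by (simp add: cis_neq_zero)
    from has_integral_divide[OF this, of \<i>] have "((\<lambda>t. h (cis t)) has_integral I / \<i>) {0..2*pi}"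
      by (simp only: nonzero_mult_div_cancel_right[OF complex_i_not_zero])
    then show ?thesis by (rule integral_unique)
  qed
  finally show ?thesis by (simp add: scaleR_conv_of_real field_simps)
qed

lemma esssup_circle_const: "esssup circle_measure (\<lambda>_. c) = c"
proof (rule esssup_const)
  show "emeasure circle_measure (space circle_measure) \<noteq> 0"
    unfolding circle.emeasure_space_1 by (rule one_neq_zero)
qed

section \<open>The Poisson integral\<close>

definition poisson_kernel :: "complex \<Rightarrow> complex \<Rightarrow> real" where
  "poisson_kernel z \<zeta> = (1 - (norm z)\<^sup>2) / (norm (\<zeta> - z))\<^sup>2"

lemma poisson_eq_kernel: "poisson f z = (LINT \<zeta>|circle_measure. poisson_kernel z \<zeta> *\<^sub>R f \<zeta>)"
  by (simp add: poisson_def poisson_kernel_def)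

lemma poisson_kernel_pos:
  assumes "norm z < 1" "norm \<zeta> = 1"
  shows "poisson_kernel z \<zeta> > 0"
proof -
  have "(norm z)\<^sup>2 < 1" using assms(1) by (simp add: power_less_one_iff)
  moreover have "\<zeta> \<noteq> z" using assms by auto
  ultimately show ?thesis by (simp add: poisson_kernel_def)
qed

lemma poisson_kernel_le:
  assumes "norm z < 1" "norm \<zeta> = 1"
  shows "poisson_kernel z \<zeta> \<le> 2 / (1 - norm z)"
proof -
  have "1 - norm z \<le> norm (\<zeta> - z)"
    using norm_triangle_ineq2[of \<zeta> z] assms by simp
  then have "(1 - norm z)\<^sup>2 \<le> (norm (\<zeta> - z))\<^sup>2"
    using assms by (intro power_mono) auto
  then have "poisson_kernel z \<zeta> \<le> (1 - (norm z)\<^sup>2) / (1 - norm z)\<^sup>2"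
    unfolding poisson_kernel_def using assms
    by (intro divide_left_mono mult_pos_pos) (auto simp: power_le_one)
  also have "\<dots> = (1 + norm z) / (1 - norm z)"
    using assms by (simp add: power2_eq_square divide_simps) (simp add: algebra_simps)
  also have "\<dots> \<le> 2 / (1 - norm z)"
    using assms by (intro divide_right_mono) auto
  finally show ?thesis .
qed

lemma continuous_on_poisson_kernel:
  assumes "norm z < 1"
  shows "continuous_on (sphere 0 1) (poisson_kernel z)"
  unfolding poisson_kernel_def using assms
  by (intro continuous_intros) auto

text \<open>Both sides depend only on \<open>r\<close> and on the angle between \<open>\<zeta>\<close> and \<open>\<omega>\<close>.\<close>

lemma poisson_kernel_dilation_commute:
  assumes "norm \<zeta> = 1" "norm \<omega> = 1"
  shows "poisson_kernel (of_real r * \<zeta>) \<omega> = poisson_kernel (of_real r * \<omega>) \<zeta>"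
proof -
  have *: "(Re \<zeta>)\<^sup>2 + (Im \<zeta>)\<^sup>2 = 1" "(Re \<omega>)\<^sup>2 + (Im \<omega>)\<^sup>2 = 1"
    using assms by (simp_all flip: cmod_power2)
  have "(norm (\<omega> - of_real r * \<zeta>))\<^sup>2 = (norm (\<zeta> - of_real r * \<omega>))\<^sup>2"
    unfolding cmod_power2 using * by simp algebra
  then show ?thesis
    using assms by (simp add: poisson_kernel_def norm_mult)
qed

text \<open>Divided by \<open>\<zeta>\<close>, the Poisson kernel is the Cauchy kernel plus a function of \<open>\<zeta>\<close> that is analytic on the closed disc;
on the circle \<open>cnj \<zeta> = 1 / \<zeta>\<close> turns the conjugate Cauchy kernel into the latter.\<close>

lemma poisson_kernel_Cauchy_split:
  assumes "norm z < 1" "norm \<zeta> = 1"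
  shows "of_real (poisson_kernel z \<zeta>) / \<zeta> = 1 / (\<zeta> - z) + cnj z / (1 - cnj z * \<zeta>)"
proof -
  have z: "\<zeta> \<noteq> 0" "\<zeta> - z \<noteq> 0" using assms by auto
  have "norm (cnj z * \<zeta>) < 1" using assms by (simp add: norm_mult)
  then have d: "1 - cnj z * \<zeta> \<noteq> 0" by auto
  have zz: "\<zeta> * cnj \<zeta> = 1" using assms by (simp add: complex_norm_square[symmetric])
  have "of_real (poisson_kernel z \<zeta>) = (1 - z * cnj z) / ((\<zeta> - z) * cnj (\<zeta> - z))"
    unfolding poisson_kernel_def by (simp add: complex_norm_square[symmetric] del: complex_cnj_diff)
  also have "(\<zeta> - z) * cnj (\<zeta> - z) * \<zeta> = (\<zeta> - z) * (1 - cnj z * \<zeta>)"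
    using zz by (simp add: algebra_simps)
  then have "(1 - z * cnj z) / ((\<zeta> - z) * cnj (\<zeta> - z)) / \<zeta> = (1 - z * cnj z) / ((\<zeta> - z) * (1 - cnj z * \<zeta>))"
    by (simp add: divide_divide_eq_left)
  also have "1 - z * cnj z = (1 - cnj z * \<zeta>) + cnj z * (\<zeta> - z)"
    by (simp add: algebra_simps)
  also have "\<dots> / ((\<zeta> - z) * (1 - cnj z * \<zeta>)) = 1 / (\<zeta> - z) + cnj z / (1 - cnj z * \<zeta>)"
    using z d by (simp add: add_divide_distrib)
  finally show ?thesis .
qed

text \<open>Of the two summands of the split kernel, the Cauchy kernel reproduces \<open>g z\<close> and the analytic one
integrates to zero.\<close>

lemma poisson_holomorphic:
  assumes gc: "continuous_on (cball 0 1) g" and gh: "g holomorphic_on ball 0 1"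
    and z: "norm z < 1"
  shows "poisson g z = g z"
proof -
  have d: "1 - cnj z * w \<noteq> 0" if "norm w \<le> 1" for w
  proof -
    have "norm (cnj z * w) < 1"
      using z that mult_left_le[of "norm w" "norm z"] by (simp add: norm_mult)
    then show ?thesis by auto
  qed
  have 1: "((\<lambda>w. g w / (w - z)) has_contour_integral (2 * of_real pi * \<i> * g z)) (circlepath 0 1)"
    using z by (intro Cauchy_integral_circlepath assms) auto
  have 2: "((\<lambda>w. g w * (cnj z / (1 - cnj z * w))) has_contour_integral 0) (circlepath 0 1)"
  proof (rule Cauchy_theorem_disc[of "{}" 0 1])
    show "continuous_on (cball 0 1) (\<lambda>w. g w * (cnj z / (1 - cnj z * w)))"
      using d by (intro continuous_intros gc) auto
    have "(\<lambda>w. g w * (cnj z / (1 - cnj z * w))) holomorphic_on ball 0 1"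
      using d by (intro holomorphic_intros gh) auto
    then show "(\<lambda>w. g w * (cnj z / (1 - cnj z * w))) field_differentiable at x"
      if "x \<in> ball 0 1 - {}" for x
      using that by (auto simp: holomorphic_on_open field_differentiable_def)
  qed (auto simp: path_image_circlepath_nonneg)
  have "((\<lambda>w. poisson_kernel z w *\<^sub>R g w / w) has_contour_integral (2 * of_real pi * \<i> * g z + 0)) (circlepath 0 1)"
  proof (rule has_contour_integral_eq[OF has_contour_integral_add[OF 1 2]])
    fix w assume "w \<in> path_image (circlepath 0 1)"
    then have w: "norm w = 1" by (simp add: path_image_circlepath_nonneg)
    have "poisson_kernel z w *\<^sub>R g w / w = g w * (of_real (poisson_kernel z w) / w)"
      by (simp add: scaleR_conv_of_real)
    then show "g w / (w - z) + g w * (cnj z / (1 - cnj z * w)) = poisson_kernel z w *\<^sub>R g w / w"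
      unfolding poisson_kernel_Cauchy_split[OF z w] by (simp add: algebra_simps)
  qed
  then have "(LINT \<zeta>|circle_measure. poisson_kernel z \<zeta> *\<^sub>R g \<zeta>) = (2 * of_real pi * \<i> * g z + 0) / (2 * pi * \<i>)"
    by (intro integral_circle_eq_contour continuous_intros continuous_on_poisson_kernel z
          continuous_on_subset[OF gc]) auto
  then show ?thesis by (simp add: poisson_eq_kernel)
qed

lemma poisson_kernel_measurable [measurable]:
  "norm z < 1 \<Longrightarrow> poisson_kernel z \<in> borel_measurable circle_measure"
  by (intro continuous_measurable_circle continuous_on_poisson_kernel)

lemma integrable_bounded_circle:
  fixes f :: "complex \<Rightarrow> 'a::{banach, second_countable_topology}"
  assumes "f \<in> borel_measurable circle_measure" "AE \<zeta> in circle_measure. norm (f \<zeta>) \<le> M"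
  shows "integrable circle_measure f"
  using assms by (intro circle.integrable_const_bound)

lemma AE_norm_eq_1: "AE \<zeta> in circle_measure. norm \<zeta> = 1"
  by (rule AE_I2) simp

lemma integrable_poisson_kernel:
  fixes f :: "complex \<Rightarrow> 'a::{banach, second_countable_topology}"
  assumes "f \<in> borel_measurable circle_measure" "AE \<zeta> in circle_measure. norm (f \<zeta>) \<le> M" "norm z < 1"
  shows "integrable circle_measure (\<lambda>\<zeta>. poisson_kernel z \<zeta> *\<^sub>R f \<zeta>)"
proof (rule integrable_bounded_circle)
  show "(\<lambda>\<zeta>. poisson_kernel z \<zeta> *\<^sub>R f \<zeta>) \<in> borel_measurable circle_measure"
    using assms by measurable
  show "AE \<zeta> in circle_measure. norm (poisson_kernel z \<zeta> *\<^sub>R f \<zeta>) \<le> 2 / (1 - norm z) * M"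
    using assms(2) AE_norm_eq_1
  proof eventually_elim
    case (elim \<zeta>)
    have "norm (poisson_kernel z \<zeta> *\<^sub>R f \<zeta>) = poisson_kernel z \<zeta> * norm (f \<zeta>)"
      using poisson_kernel_pos[OF assms(3) elim(2)] by simp
    also have "\<dots> \<le> 2 / (1 - norm z) * M"
      using poisson_kernel_le[OF assms(3) elim(2)] elim(1) assms(3) by (intro mult_mono) auto
    finally show ?case .
  qed
qed

lemma integral_poisson_kernel:
  assumes "norm z < 1"
  shows "(LINT \<zeta>|circle_measure. poisson_kernel z \<zeta>) = 1"
proof -
  have "poisson (\<lambda>_. 1::complex) z = 1"
    using assms by (intro poisson_holomorphic) auto
  then have "of_real (LINT \<zeta>|circle_measure. poisson_kernel z \<zeta>) = (1::complex)"
    by (simp add: poisson_eq_kernel scaleR_conv_of_real)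
  then show ?thesis by (simp only: of_real_eq_1_iff)
qed

lemma poisson_cong_AE:
  fixes f g :: "complex \<Rightarrow> 'a::{banach, second_countable_topology}"
  assumes "f \<in> borel_measurable circle_measure" "AE \<zeta> in circle_measure. f \<zeta> = g \<zeta>" "norm z < 1"
  shows "poisson f z = poisson g z"
  unfolding poisson_eq_kernel
proof (rule integral_cong_AE)
  note [measurable] = assms(1) measurable_circle_AE_cong[OF assms(1,2)]
  show "(\<lambda>\<zeta>. poisson_kernel z \<zeta> *\<^sub>R f \<zeta>) \<in> borel_measurable circle_measure"
    "(\<lambda>\<zeta>. poisson_kernel z \<zeta> *\<^sub>R g \<zeta>) \<in> borel_measurable circle_measure"
    using assms(3) by measurable
  show "AE \<zeta> in circle_measure. poisson_kernel z \<zeta> *\<^sub>R f \<zeta> = poisson_kernel z \<zeta> *\<^sub>R g \<zeta>"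
    using assms(2) by eventually_elim simp
qed

lemma poisson_const_real:
  fixes c :: real
  assumes "norm z < 1"
  shows "poisson (\<lambda>_. c) z = c"
  using integral_poisson_kernel[OF assms] by (simp add: poisson_eq_kernel)

lemma poisson_mult_left:
  fixes f :: "complex \<Rightarrow> complex"
  shows "poisson (\<lambda>\<zeta>. c * f \<zeta>) z = c * poisson f z"
  by (simp add: poisson_eq_kernel flip: integral_mult_right_zero)

lemma poisson_le:
  fixes u :: "complex \<Rightarrow> real"
  assumes "u \<in> borel_measurable circle_measure" "AE \<zeta> in circle_measure. norm (u \<zeta>) \<le> M" "norm z < 1"
  shows "poisson u z \<le> M"
proof -
  have "poisson u z \<le> poisson (\<lambda>_. M) z"
    unfolding poisson_eq_kernel
  proof (rule integral_mono_AE)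
    show "AE \<zeta> in circle_measure. poisson_kernel z \<zeta> *\<^sub>R u \<zeta> \<le> poisson_kernel z \<zeta> *\<^sub>R M"
      using assms(2) AE_norm_eq_1
    proof eventually_elim
      case (elim \<zeta>)
      then show ?case using poisson_kernel_pos[OF assms(3) elim(2)] by (intro scaleR_left_mono) auto
    qed
  qed (intro integrable_poisson_kernel[where M="\<bar>M\<bar>"] integrable_poisson_kernel[where M=M] assms; auto)+
  with poisson_const_real[OF assms(3)] show ?thesis by metis
qed

text \<open>The nonnegative function \<open>M - u\<close> has integral \<open>M - Pu(z) = 0\<close> against the strictly positive
Poisson kernel.\<close>

lemma poisson_attains_bound_imp_AE_eq:
  fixes u :: "complex \<Rightarrow> real"
  assumes u: "u \<in> borel_measurable circle_measure" "AE \<zeta> in circle_measure. norm (u \<zeta>) \<le> M"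
    and z: "norm z < 1" and eq: "poisson u z = M"
  shows "AE \<zeta> in circle_measure. u \<zeta> = M"
proof -
  let ?d = "\<lambda>\<zeta>. poisson_kernel z \<zeta> *\<^sub>R M - poisson_kernel z \<zeta> *\<^sub>R u \<zeta>"
  have i1: "integrable circle_measure (\<lambda>\<zeta>. poisson_kernel z \<zeta> *\<^sub>R M)"
    by (rule integrable_poisson_kernel[where M="\<bar>M\<bar>"]) (auto simp: z)
  have i2: "integrable circle_measure (\<lambda>\<zeta>. poisson_kernel z \<zeta> *\<^sub>R u \<zeta>)"
    by (rule integrable_poisson_kernel[OF u z])
  have "(LINT \<zeta>|circle_measure. ?d \<zeta>) = poisson (\<lambda>_. M) z - poisson u z"
    unfolding poisson_eq_kernel by (rule Bochner_Integration.integral_diff[OF i1 i2])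
  also have "\<dots> = 0" using eq poisson_const_real[OF z, of M] by linarith
  finally have 0: "(LINT \<zeta>|circle_measure. ?d \<zeta>) = 0" .
  have "AE \<zeta> in circle_measure. 0 \<le> ?d \<zeta>"
    using u(2) AE_norm_eq_1
  proof eventually_elim
    case (elim \<zeta>)
    then show ?case using poisson_kernel_pos[OF z elim(2)] by (simp add: mult_left_mono)
  qed
  from integral_nonneg_eq_0_iff_AE[OF Bochner_Integration.integrable_diff[OF i1 i2] this] 0
  have "AE \<zeta> in circle_measure. ?d \<zeta> = 0" by simp
  then show ?thesis using AE_norm_eq_1
  proof eventually_elim
    case (elim \<zeta>)
    then show ?case using poisson_kernel_pos[OF z elim(2)] by auto
  qed
qed

text \<open>Dominated convergence: the kernels \<open>poisson_kernel z\<close> are uniformly bounded for \<open>norm z < r\<close> with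
\<open>r < 1\<close>, though not on the whole disc. Hence the argument runs on the smaller balls, which exhaust
the disc.\<close>

lemma continuous_on_poisson:
  fixes f :: "complex \<Rightarrow> 'a::{banach, second_countable_topology}"
  assumes f: "f \<in> borel_measurable circle_measure" "AE \<zeta> in circle_measure. norm (f \<zeta>) \<le> M"
  shows "continuous_on (ball 0 1) (poisson f)"
proof -
  have *: "continuous_on (ball 0 r) (poisson f)" if r: "0 < r" "r < 1" for r
    unfolding continuous_on_sequentially comp_def poisson_eq_kernel
  proof safe
    fix x :: "nat \<Rightarrow> complex" and a
    assume a: "a \<in> ball 0 r" and x: "\<forall>n. x n \<in> ball 0 r" and lim: "x \<longlonglongrightarrow> a"
    have xr: "norm (x n) < r" for n using x by auto
    have xn: "norm (x n) < 1" for n using xr[of n] r by linarith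
    have an: "norm a < 1" using a r by auto
    show "(\<lambda>n. LINT \<zeta>|circle_measure. poisson_kernel (x n) \<zeta> *\<^sub>R f \<zeta>)
       \<longlonglongrightarrow> (LINT \<zeta>|circle_measure. poisson_kernel a \<zeta> *\<^sub>R f \<zeta>)"
    proof (rule integral_dominated_convergence)
      show "(\<lambda>\<zeta>. poisson_kernel a \<zeta> *\<^sub>R f \<zeta>) \<in> borel_measurable circle_measure"
        "(\<lambda>\<zeta>. poisson_kernel (x n) \<zeta> *\<^sub>R f \<zeta>) \<in> borel_measurable circle_measure" for n
        using f(1) xn an by measurable
      show "integrable circle_measure (\<lambda>_. 2 / (1 - r) * M)" by simp
      show "AE \<zeta> in circle_measure. (\<lambda>n. poisson_kernel (x n) \<zeta> *\<^sub>R f \<zeta>) \<longlonglongrightarrow> poisson_kernel a \<zeta> *\<^sub>R f \<zeta>"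
        using AE_norm_eq_1
      proof eventually_elim
        case (elim \<zeta>)
        have "\<zeta> \<noteq> a" using elim an by auto
        then show ?case unfolding poisson_kernel_def by (intro tendsto_intros lim) auto
      qed
      show "AE \<zeta> in circle_measure. norm (poisson_kernel (x n) \<zeta> *\<^sub>R f \<zeta>) \<le> 2 / (1 - r) * M" for n
        using f(2) AE_norm_eq_1
      proof eventually_elim
        case (elim \<zeta>)
        have "norm (poisson_kernel (x n) \<zeta> *\<^sub>R f \<zeta>) = poisson_kernel (x n) \<zeta> * norm (f \<zeta>)"
          using poisson_kernel_pos[OF xn elim(2)] by (simp add: less_imp_le)
        also have "\<dots> \<le> 2 / (1 - norm (x n)) * M"
          using poisson_kernel_le[OF xn elim(2)] elim(1) xn[of n] by (intro mult_mono) auto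
        also have "\<dots> \<le> 2 / (1 - r) * M"
          using xr[of n] r xn[of n] elim(1) norm_ge_zero[of "f \<zeta>"]
          by (intro mult_right_mono divide_left_mono) (auto intro: order_trans[OF norm_ge_zero])
        finally show ?case .
      qed
    qed
  qed
  show ?thesis
  proof (rule continuous_at_imp_continuous_on, rule ballI)
    fix a :: complex assume "a \<in> ball 0 1"
    then have a: "a \<in> ball 0 ((1 + norm a) / 2)" and r: "0 < (1 + norm a) / 2" "(1 + norm a) / 2 < 1"
      by (auto intro: add_pos_nonneg)
    from *[OF r] a show "isCont (poisson f) a"
      by (simp add: continuous_on_eq_continuous_at)
  qed
qed

section \<open>Uniqueness of boundary values\<close>

text \<open>Fubini's theorem and the symmetry of \<open>(\<zeta>, \<omega>) \<mapsto> poisson_kernel (r \<zeta>) \<omega>\<close>.\<close>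

lemma poisson_dilation_self_adjoint:
  fixes u v :: "complex \<Rightarrow> complex"
  assumes u: "u \<in> borel_measurable circle_measure" "AE \<zeta> in circle_measure. norm (u \<zeta>) \<le> M"
    and v: "v \<in> borel_measurable circle_measure" "AE \<zeta> in circle_measure. norm (v \<zeta>) \<le> N"
    and r: "0 \<le> r" "r < 1"
  shows "(LINT \<zeta>|circle_measure. u \<zeta> * poisson v (of_real r * \<zeta>)) =
         (LINT \<omega>|circle_measure. poisson u (of_real r * \<omega>) * v \<omega>)"
proof -
  interpret P: pair_sigma_finite circle_measure circle_measure
    by unfold_locales
  interpret PP: pair_prob_space circle_measure circle_measure
    by unfold_locales
  let ?F = "\<lambda>\<zeta> \<omega>. poisson_kernel (of_real r * \<zeta>) \<omega> *\<^sub>R (u \<zeta> * v \<omega>)"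
  have nr: "norm (of_real r * \<zeta>) = r" if "norm \<zeta> = 1" for \<zeta> :: complex
    using that r by (simp add: norm_mult)
  have [measurable]: "(\<lambda>\<zeta>. \<zeta>) \<in> borel_measurable circle_measure"
    by (intro continuous_measurable_circle continuous_intros)
  note [measurable] = u(1) v(1)
  have F: "case_prod ?F \<in> borel_measurable (circle_measure \<Otimes>\<^sub>M circle_measure)"
    unfolding poisson_kernel_def by measurable
  have bd: "AE p in circle_measure \<Otimes>\<^sub>M circle_measure. norm (case_prod ?F p) \<le> 2 / (1 - r) * (M * N)"
  proof (rule P.AE_pair_measure)
    show "{p \<in> space (circle_measure \<Otimes>\<^sub>M circle_measure). norm (case_prod ?F p) \<le> 2 / (1 - r) * (M * N)}
        \<in> sets (circle_measure \<Otimes>\<^sub>M circle_measure)"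
      using F by measurable
    show "AE \<zeta> in circle_measure. AE \<omega> in circle_measure. norm (case_prod ?F (\<zeta>, \<omega>)) \<le> 2 / (1 - r) * (M * N)"
      using u(2) AE_norm_eq_1
    proof eventually_elim
      case 1: (elim \<zeta>)
      show ?case using v(2) AE_norm_eq_1
      proof eventually_elim
        case (elim \<omega>)
        have n: "norm (of_real r * \<zeta>) < 1" using nr[OF 1(2)] r by simp
        have "norm (case_prod ?F (\<zeta>, \<omega>)) = poisson_kernel (of_real r * \<zeta>) \<omega> * (norm (u \<zeta>) * norm (v \<omega>))"
          using poisson_kernel_pos[OF n elim(2)] by (simp add: norm_mult)
        also have "\<dots> \<le> 2 / (1 - r) * (M * N)"
          using poisson_kernel_le[OF n elim(2)] nr[OF 1(2)] r 1(1) elim(1)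
          by (intro mult_mono) (auto intro: order_trans[OF norm_ge_zero])
        finally show ?case .
      qed
    qed
  qed
  have int: "integrable (circle_measure \<Otimes>\<^sub>M circle_measure) (case_prod ?F)"
    using bd F by (rule PP.integrable_const_bound)
  have "(LINT \<zeta>|circle_measure. u \<zeta> * poisson v (of_real r * \<zeta>)) = (LINT \<zeta>|circle_measure. LINT \<omega>|circle_measure. ?F \<zeta> \<omega>)"
    by (simp add: poisson_eq_kernel flip: integral_mult_right_zero)
  also have "\<dots> = (LINT \<omega>|circle_measure. LINT \<zeta>|circle_measure. ?F \<zeta> \<omega>)"
    by (rule P.Fubini_integral[OF int, symmetric])
  also have "\<dots> = (LINT \<omega>|circle_measure. poisson u (of_real r * \<omega>) * v \<omega>)"
  proof (rule Bochner_Integration.integral_cong[OF refl])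
    fix \<omega> assume "\<omega> \<in> space circle_measure"
    then have w: "norm \<omega> = 1" by simp
    have "(LINT \<zeta>|circle_measure. ?F \<zeta> \<omega>) =
      (LINT \<zeta>|circle_measure. (poisson_kernel (of_real r * \<omega>) \<zeta> *\<^sub>R u \<zeta>) * v \<omega>)"
      using poisson_kernel_dilation_commute[OF _ w]
      by (intro Bochner_Integration.integral_cong refl) auto
    then show "(LINT \<zeta>|circle_measure. ?F \<zeta> \<omega>) = poisson u (of_real r * \<omega>) * v \<omega>"
      by (simp add: poisson_eq_kernel flip: integral_mult_left_zero)
  qed
  finally show ?thesis .
qed

lemma poisson_cnj: "poisson (\<lambda>\<zeta>. cnj (f \<zeta>)) z = cnj (poisson f z)"
proof -
  have "cnj (poisson f z) = (LINT \<zeta>|circle_measure. cnj (poisson_kernel z \<zeta> *\<^sub>R f \<zeta>))"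
    unfolding poisson_eq_kernel by (rule Bochner_Integration.integral_cnj[symmetric])
  then show ?thesis by (simp add: poisson_eq_kernel)
qed

text \<open>Symmetry of the dilated Poisson operators moves the comparison into the disc, where \<open>Pu = g\<close> is
known: \<open>\<integral> u(\<zeta>) \<cdot> cnj (g(r\<zeta>)) dm = \<integral> g(r\<zeta>) \<cdot> cnj (g(\<zeta>)) dm\<close> for \<open>r < 1\<close>. Letting \<open>r \<longlongrightarrow> 1\<close> gives
\<open>\<integral> u \<cdot> cnj g dm = \<integral> |g|\<^sup>2 dm\<close>. Since \<open>|u| \<le> |g|\<close>, this is the equality case of the Cauchy--Schwarz
inequality, and it forces \<open>u = g\<close>.\<close>

lemma boundary_values_unique:
  fixes u g :: "complex \<Rightarrow> complex"
  assumes u: "u \<in> borel_measurable circle_measure"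
    and le: "AE \<zeta> in circle_measure. norm (u \<zeta>) \<le> norm (g \<zeta>)"
    and gc: "continuous_on (cball 0 1) g" and gh: "g holomorphic_on ball 0 1"
    and eq: "\<And>z. norm z < 1 \<Longrightarrow> poisson u z = g z"
  shows "AE \<zeta> in circle_measure. u \<zeta> = g \<zeta>"
proof -
  note [measurable] = u
  have gm [measurable]: "g \<in> borel_measurable circle_measure"
    by (intro continuous_measurable_circle continuous_on_subset[OF gc]) auto
  have "bounded (g ` cball 0 1)"
    using gc by (intro compact_imp_bounded compact_continuous_image) auto
  then obtain K where K: "\<And>z. norm z \<le> 1 \<Longrightarrow> norm (g z) \<le> K"
    unfolding bounded_iff by force
  have K0: "0 \<le> K" using K[of 0] norm_ge_zero[of "g 0"] by (auto simp del: norm_ge_zero)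
  have uK: "AE \<zeta> in circle_measure. norm (u \<zeta>) \<le> K"
    using le AE_norm_eq_1
  proof eventually_elim
    case (elim \<zeta>)
    then show ?case using K[of \<zeta>] by simp
  qed
  have gK: "AE \<zeta> in circle_measure. norm (g \<zeta>) \<le> K"
    by (rule AE_I2) (simp add: K)
  define r :: "nat \<Rightarrow> real" where "r n = 1 - inverse (real (Suc n))" for n
  have r: "0 \<le> r n" "r n < 1" for n by (auto simp: r_def inverse_le_1_iff)
  have "(\<lambda>n. 1 - inverse (real (Suc n))) \<longlonglongrightarrow> 1 - 0"
    by (intro tendsto_intros LIMSEQ_inverse_real_of_nat)
  then have rlim: "r \<longlonglongrightarrow> 1" unfolding r_def by simp
  have nr: "norm (of_real (r n) * \<zeta>) < 1" if "norm \<zeta> = 1" for \<zeta> :: complex and n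
    using r[of n] that by (simp add: norm_mult)
  have lim: "(\<lambda>n. g (of_real (r n) * \<zeta>)) \<longlonglongrightarrow> g \<zeta>" if "norm \<zeta> = 1" for \<zeta>
  proof (rule continuous_on_tendsto_compose[OF gc])
    have "(\<lambda>n. of_real (r n) * \<zeta>) \<longlonglongrightarrow> of_real 1 * \<zeta>" by (intro tendsto_intros rlim)
    then show "(\<lambda>n. of_real (r n) * \<zeta>) \<longlonglongrightarrow> \<zeta>" by simp
    show "\<forall>\<^sub>F n in sequentially. of_real (r n) * \<zeta> \<in> cball 0 1"
      using nr[OF that] by (intro always_eventually) (auto simp: less_imp_le)
  qed (use that in auto)
  have grm: "(\<lambda>\<zeta>. g (of_real (r n) * \<zeta>)) \<in> borel_measurable circle_measure" for n
    using nr
    by (intro continuous_measurable_circle continuous_on_compose2[OF gc] continuous_intros) (auto simp: less_imp_le)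
  have limint: "(\<lambda>n. LINT \<zeta>|circle_measure. w \<zeta> * k (g (of_real (r n) * \<zeta>)))
     \<longlonglongrightarrow> (LINT \<zeta>|circle_measure. w \<zeta> * k (g \<zeta>))"
    if wm [measurable]: "w \<in> borel_measurable circle_measure" and wK: "AE \<zeta> in circle_measure. norm (w \<zeta>) \<le> K"
      and k: "continuous_on UNIV k" "\<And>x. norm (k x) = norm x" for w k :: "complex \<Rightarrow> complex"
  proof (rule integral_dominated_convergence)
    have [measurable]: "k \<in> borel_measurable borel"
      by (intro borel_measurable_continuous_onI k)
    note [measurable] = grm
    show "(\<lambda>\<zeta>. w \<zeta> * k (g \<zeta>)) \<in> borel_measurable circle_measure" by measurable
    show "(\<lambda>\<zeta>. w \<zeta> * k (g (of_real (r n) * \<zeta>))) \<in> borel_measurable circle_measure" for n by measurable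
    show "integrable circle_measure (\<lambda>_. K * K)" by simp
    show "AE \<zeta> in circle_measure. (\<lambda>n. w \<zeta> * k (g (of_real (r n) * \<zeta>))) \<longlonglongrightarrow> w \<zeta> * k (g \<zeta>)"
      using AE_norm_eq_1
    proof eventually_elim
      case (elim \<zeta>)
      show ?case
        by (intro tendsto_intros continuous_on_tendsto_compose[OF k(1) lim[OF elim]]) auto
    qed
    show "AE \<zeta> in circle_measure. norm (w \<zeta> * k (g (of_real (r n) * \<zeta>))) \<le> K * K" for n
      using wK AE_norm_eq_1
    proof eventually_elim
      case (elim \<zeta>)
      show ?case using elim(1) K[OF less_imp_le[OF nr[OF elim(2)]], of n] K0
        by (auto simp: norm_mult k intro!: mult_mono)
    qed
  qed
  have same: "(LINT \<zeta>|circle_measure. u \<zeta> * cnj (g (of_real (r n) * \<zeta>))) =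
      (LINT \<zeta>|circle_measure. cnj (g \<zeta>) * g (of_real (r n) * \<zeta>))" for n
  proof -
    have "(LINT \<zeta>|circle_measure. u \<zeta> * cnj (g (of_real (r n) * \<zeta>))) =
       (LINT \<zeta>|circle_measure. u \<zeta> * poisson (\<lambda>\<zeta>. cnj (g \<zeta>)) (of_real (r n) * \<zeta>))"
      using poisson_holomorphic[OF gc gh] nr
      by (intro Bochner_Integration.integral_cong refl) (simp add: poisson_cnj)
    also have "\<dots> = (LINT \<zeta>|circle_measure. poisson u (of_real (r n) * \<zeta>) * cnj (g \<zeta>))"
    proof (rule poisson_dilation_self_adjoint[OF u uK _ _ r])
      show "(\<lambda>\<zeta>. cnj (g \<zeta>)) \<in> borel_measurable circle_measure"
        by (intro continuous_measurable_circle continuous_intros continuous_on_subset[OF gc]) auto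
      show "AE \<zeta> in circle_measure. norm (cnj (g \<zeta>)) \<le> K" using gK by simp
    qed
    also have "\<dots> = (LINT \<zeta>|circle_measure. cnj (g \<zeta>) * g (of_real (r n) * \<zeta>))"
      using eq nr by (intro Bochner_Integration.integral_cong refl) simp
    finally show ?thesis .
  qed
  have cgm [measurable]: "(\<lambda>\<zeta>. cnj (g \<zeta>)) \<in> borel_measurable circle_measure"
    by (intro continuous_measurable_circle continuous_intros continuous_on_subset[OF gc]) auto
  have E: "(LINT \<zeta>|circle_measure. u \<zeta> * cnj (g \<zeta>)) = (LINT \<zeta>|circle_measure. cnj (g \<zeta>) * g \<zeta>)"
  proof (rule LIMSEQ_unique)
    show "(\<lambda>n. LINT \<zeta>|circle_measure. u \<zeta> * cnj (g (of_real (r n) * \<zeta>)))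
        \<longlonglongrightarrow> (LINT \<zeta>|circle_measure. u \<zeta> * cnj (g \<zeta>))"
      by (rule limint) (auto intro!: uK continuous_intros)
    have "(\<lambda>n. LINT \<zeta>|circle_measure. cnj (g \<zeta>) * g (of_real (r n) * \<zeta>))
        \<longlonglongrightarrow> (LINT \<zeta>|circle_measure. cnj (g \<zeta>) * g \<zeta>)"
      by (rule limint[of "\<lambda>\<zeta>. cnj (g \<zeta>)" "\<lambda>x. x"]) (use gK in \<open>auto intro!: continuous_intros\<close>)
    then show "(\<lambda>n. LINT \<zeta>|circle_measure. u \<zeta> * cnj (g (of_real (r n) * \<zeta>)))
        \<longlonglongrightarrow> (LINT \<zeta>|circle_measure. cnj (g \<zeta>) * g \<zeta>)"
      unfolding same .
  qed
  let ?d = "\<lambda>\<zeta>. cnj (g \<zeta>) * g \<zeta> - u \<zeta> * cnj (g \<zeta>)"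
  have i1: "integrable circle_measure (\<lambda>\<zeta>. cnj (g \<zeta>) * g \<zeta>)"
    by (rule integrable_bounded_circle[where M="K * K"])
       (measurable, use gK in eventually_elim, auto simp: norm_mult K0 intro!: mult_mono)
  have i2: "integrable circle_measure (\<lambda>\<zeta>. u \<zeta> * cnj (g \<zeta>))"
    by (rule integrable_bounded_circle[where M="K * K"])
       (measurable, use gK uK in eventually_elim, auto simp: norm_mult K0 intro!: mult_mono)
  have di: "integrable circle_measure ?d" by (intro Bochner_Integration.integrable_diff i1 i2)
  have "(LINT \<zeta>|circle_measure. 2 * Re (?d \<zeta>)) = 2 * Re (LINT \<zeta>|circle_measure. ?d \<zeta>)"
    by (simp only: integral_mult_right_zero integral_Re[OF di])
  also have "\<dots> = 0"
    by (simp only: Bochner_Integration.integral_diff[OF i1 i2] E) simp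
  finally have int0: "(LINT \<zeta>|circle_measure. 2 * Re (?d \<zeta>)) = 0" .
  \<comment> \<open>Expand the square and use \<open>|u|\<^sup>2 \<le> |g|\<^sup>2\<close>.\<close>
  have ge: "AE \<zeta> in circle_measure. (norm (u \<zeta> - g \<zeta>))\<^sup>2 \<le> 2 * Re (?d \<zeta>)"
    using le
  proof eventually_elim
    case (elim \<zeta>)
    have "(norm (u \<zeta>))\<^sup>2 \<le> (norm (g \<zeta>))\<^sup>2" using elim by (intro power_mono) auto
    then show ?case unfolding cmod_power2 by (simp add: power2_eq_square algebra_simps)
  qed
  have "AE \<zeta> in circle_measure. 0 \<le> 2 * Re (?d \<zeta>)"
    using ge by eventually_elim (rule order_trans[OF zero_le_power2])
  moreover have "integrable circle_measure (\<lambda>\<zeta>. 2 * Re (?d \<zeta>))"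
    using di by (intro integrable_mult_right integrable_Re)
  ultimately have "AE \<zeta> in circle_measure. 2 * Re (?d \<zeta>) = 0"
    using int0 integral_nonneg_eq_0_iff_AE by blast
  then show ?thesis using ge
  proof eventually_elim
    case (elim \<zeta>)
    then have "(norm (u \<zeta> - g \<zeta>))\<^sup>2 \<le> 0" by simp
    then show ?case by simp
  qed
qed

section \<open>Finite Blaschke products and unimodular boundary behaviour\<close>

abbreviation boundary_filter :: "complex filter" where
  "boundary_filter \<equiv> filtercomap norm (at_left 1)"

lemma eventually_boundary_filter:
  "eventually P boundary_filter \<longleftrightarrow> (\<exists>r<1. \<forall>z. r < norm z \<and> norm z < 1 \<longrightarrow> P z)"
proof
  assume "eventually P boundary_filter"
  then obtain Q where Q: "eventually Q (at_left (1::real))" "\<And>z. Q (norm z) \<Longrightarrow> P z"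
    unfolding eventually_filtercomap by auto
  from Q(1) obtain b where "b < 1" "\<And>y. b < y \<Longrightarrow> y < 1 \<Longrightarrow> Q y"
    by (auto simp: eventually_at_left[of 0])
  then show "\<exists>r<1. \<forall>z. r < norm z \<and> norm z < 1 \<longrightarrow> P z" using Q(2) by blast
next
  assume "\<exists>r<1. \<forall>z. r < norm z \<and> norm z < 1 \<longrightarrow> P z"
  then obtain r where r: "r < 1" "\<And>z. r < norm z \<Longrightarrow> norm z < 1 \<Longrightarrow> P z" by auto
  have "eventually (\<lambda>y. r < y \<and> y < 1) (at_left (1::real))"
    using r(1) by (auto simp: eventually_at_left[of 0])
  then show "eventually P boundary_filter"
    unfolding eventually_filtercomap using r(2) by blast
qed

text \<open>Uniform continuity compares \<open>B z\<close> with its value at the radial projection \<open>sgn z\<close>.\<close>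

lemma norm_tends_to_1_at_boundary:
  fixes B :: "complex \<Rightarrow> complex"
  assumes B: "continuous_on (cball 0 1) B" and 1: "\<And>z. norm z = 1 \<Longrightarrow> norm (B z) = 1"
  shows "((\<lambda>z. norm (B z)) \<longlongrightarrow> 1) boundary_filter"
proof (rule tendstoI)
  fix e :: real assume "e > 0"
  have "uniformly_continuous_on (cball 0 1) B"
    by (intro compact_uniformly_continuous B) auto
  then obtain d where d: "d > 0" "\<And>z w. z \<in> cball 0 1 \<Longrightarrow> w \<in> cball 0 1 \<Longrightarrow> dist w z < d \<Longrightarrow> dist (B w) (B z) < e"
    unfolding uniformly_continuous_on_def using \<open>e > 0\<close> by metis
  show "eventually (\<lambda>z. dist (norm (B z)) 1 < e) boundary_filter"
    unfolding eventually_boundary_filter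
  proof (intro exI conjI allI impI)
    show "max 0 (1 - d) < 1" using d by auto
    fix z :: complex assume z: "max 0 (1 - d) < norm z \<and> norm z < 1"
    then have z0: "z \<noteq> 0" by auto
    have "z - sgn z = of_real (norm z - 1) * sgn z"
      using z0 by (simp add: sgn_div_norm scaleR_conv_of_real field_simps)
    then have "dist z (sgn z) = \<bar>norm z - 1\<bar> * norm (sgn z)"
      by (simp only: dist_norm norm_mult norm_of_real)
    then have "dist z (sgn z) = 1 - norm z"
      using z z0 by (simp add: norm_sgn)
    then have "dist (B z) (B (sgn z)) < e"
      using z z0 by (intro d) (auto simp: norm_sgn)
    moreover have "norm (B (sgn z)) = 1" using z0 by (intro 1) (simp add: norm_sgn)
    ultimately show "dist (norm (B z)) 1 < e"
      using norm_triangle_ineq3[of "B z" "B (sgn z)"] by (simp add: dist_norm)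
  qed
qed

text \<open>The maximum principle on discs of radius \<open>R < 1\<close> close to one; \<open>h\<close> may have no boundary values.\<close>

lemma norm_le_boundary_limit:
  fixes h :: "complex \<Rightarrow> complex"
  assumes h: "h holomorphic_on ball 0 1" and lim: "((\<lambda>z. norm (h z)) \<longlongrightarrow> L) boundary_filter"
    and z: "norm z < 1"
  shows "norm (h z) \<le> L"
proof (rule field_le_epsilon)
  fix e :: real assume "e > 0"
  then have "eventually (\<lambda>z. norm (h z) < L + e) boundary_filter"
    by (intro order_tendstoD(2)[OF lim]) auto
  then obtain r where r: "r < 1" "\<And>w. r < norm w \<Longrightarrow> norm w < 1 \<Longrightarrow> norm (h w) < L + e"
    unfolding eventually_boundary_filter by auto
  define R where "R = (1 + max r (norm z)) / 2"
  have R: "0 < R" "r < R" "R < 1" "norm z \<le> R"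
    using z r norm_ge_zero[of z] by (auto simp: R_def max_def simp del: norm_ge_zero)
  show "norm (h z) \<le> L + e"
  proof (rule maximum_modulus_frontier[of h "cball 0 R"])
    show "h holomorphic_on interior (cball 0 R)"
      using R by (intro holomorphic_on_subset[OF h]) auto
    show "continuous_on (closure (cball 0 R)) h"
      using R by (intro continuous_on_subset[OF holomorphic_on_imp_continuous_on[OF h]]) auto
    show "norm (h w) \<le> L + e" if "w \<in> frontier (cball 0 R)" for w
      using that R by (intro less_imp_le r(2)) auto
  qed (use R in auto)
qed

lemma zero_unimodular_boundary_imp_nonconstant:
  fixes g :: "complex \<Rightarrow> complex"
  assumes lim: "((\<lambda>z. norm (g z)) \<longlongrightarrow> 1) boundary_filter" and a: "norm a < 1" "g a = 0"
  shows "\<not> g constant_on ball 0 1"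
proof
  assume "g constant_on ball 0 1"
  then have z: "\<And>z. norm z < 1 \<Longrightarrow> g z = 0" using a by (auto simp: constant_on_def)
  have "eventually (\<lambda>z. 0 < norm (g z)) boundary_filter"
    by (intro order_tendstoD(1)[OF lim]) auto
  then obtain r where r: "r < 1" "\<And>w. r < norm w \<Longrightarrow> norm w < 1 \<Longrightarrow> 0 < norm (g w)"
    unfolding eventually_boundary_filter by auto
  define w :: complex where "w = of_real ((1 + max r 0) / 2)"
  have "norm w = (1 + max r 0) / 2" unfolding w_def by (subst norm_of_real) auto
  then have "r < norm w" "norm w < 1" using r(1) by auto
  with r(2)[of w] z[of w] show False by auto
qed

text \<open>The boundary limit bounds both \<open>h\<close> and \<open>1 / h\<close> by one, so \<open>|h| = 1\<close> throughout the disc.\<close>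

lemma zero_free_unimodular_boundary_imp_const:
  fixes h :: "complex \<Rightarrow> complex"
  assumes h: "h holomorphic_on ball 0 1" and lim: "((\<lambda>z. norm (h z)) \<longlongrightarrow> 1) boundary_filter"
    and nz: "\<And>z. norm z < 1 \<Longrightarrow> h z \<noteq> 0"
  obtains c where "norm c = 1" "\<And>z. norm z < 1 \<Longrightarrow> h z = c"
proof -
  have 1: "norm (h z) = 1" if z: "norm z < 1" for z
  proof -
    have "((\<lambda>z. inverse (norm (h z))) \<longlongrightarrow> inverse 1) boundary_filter"
      by (intro tendsto_intros lim) auto
    then have "norm (inverse (h z)) \<le> 1"
      using nz by (intro norm_le_boundary_limit[OF _ _ z]) (auto intro!: holomorphic_intros h simp: norm_inverse)
    moreover have "norm (h z) \<le> 1" by (rule norm_le_boundary_limit[OF h lim z])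
    ultimately show ?thesis using nz[OF z] by (simp add: norm_inverse inverse_le_1_iff)
  qed
  have "h constant_on ball 0 1"
    by (rule maximum_modulus_principle[OF h, where U="ball 0 1" and \<xi>=0]) (auto simp: 1)
  then obtain c where "\<And>z. norm z < 1 \<Longrightarrow> h z = c" by (auto simp: constant_on_def)
  with 1[of 0] show ?thesis by (intro that[of c]) auto
qed

lemma blaschke_denominator_nonzero:
  assumes "norm a < 1" "norm z \<le> 1"
  shows "cnj a * z \<noteq> 1"
proof -
  have "norm (cnj a * z) < 1"
    using assms mult_left_le[of "norm z" "norm a"] by (simp add: norm_mult)
  then show ?thesis by auto
qed

lemma blaschke_factor_eq_0_iff:
  assumes "norm a < 1" "norm z \<le> 1"
  shows "blaschke_factor a z = 0 \<longleftrightarrow> z = a"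
  using blaschke_denominator_nonzero[OF assms] by (auto simp: blaschke_factor_def)

lemma norm_blaschke_factor_circle:
  assumes "norm a < 1" "norm z = 1"
  shows "norm (blaschke_factor a z) = 1"
proof -
  have zz: "z * cnj z = 1" using assms by (simp add: complex_norm_square[symmetric])
  have "1 - cnj a * z = - z * cnj (a - z)" using zz by (simp add: algebra_simps)
  then have "norm (1 - cnj a * z) = norm (a - z)"
    using assms by (simp add: norm_mult del: complex_cnj_diff)
  moreover have "a \<noteq> z" using assms by auto
  ultimately show ?thesis by (simp add: blaschke_factor_def norm_mult norm_divide)
qed

lemma holomorphic_on_blaschke_factor:
  "norm a < 1 \<Longrightarrow> blaschke_factor a holomorphic_on ball 0 1"
  unfolding blaschke_factor_def
  by (cases "a = 0") (auto intro!: holomorphic_intros simp: blaschke_denominator_nonzero less_imp_le)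

lemma continuous_on_blaschke_factor:
  "norm a < 1 \<Longrightarrow> continuous_on (cball 0 1) (blaschke_factor a)"
  unfolding blaschke_factor_def
  by (cases "a = 0") (auto intro!: continuous_intros simp: blaschke_denominator_nonzero)

lemma finite_blaschke_productE:
  assumes "finite_blaschke_product B"
  obtains n :: nat and b where "\<And>j. j < n \<Longrightarrow> norm (b j) < 1"
    and "\<And>z. norm z \<le> 1 \<Longrightarrow> B z = (\<Prod>j<n. blaschke_factor (b j) z)"
proof -
  obtain n and b :: "nat \<Rightarrow> complex" where "\<forall>j<n. b j \<in> ball 0 1"
    "\<forall>z\<in>cball 0 1. B z = (\<Prod>j<n. blaschke_factor (b j) z)"
    using assms unfolding finite_blaschke_product_def by blast
  then show thesis by (intro that[of n b]) auto
qed

lemma finite_blaschke_product_one: "finite_blaschke_product (\<lambda>_. 1)"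
  unfolding finite_blaschke_product_def by (intro exI[of _ 0]) auto

lemma finite_blaschke_product_mult_factor:
  assumes "norm a < 1" "finite_blaschke_product B"
  shows "finite_blaschke_product (\<lambda>z. blaschke_factor a z * B z)"
proof -
  obtain n :: nat and b where b: "\<And>j. j < n \<Longrightarrow> norm (b j) < 1"
    "\<And>z. norm z \<le> 1 \<Longrightarrow> B z = (\<Prod>j<n. blaschke_factor (b j) z)"
    by (rule finite_blaschke_productE[OF assms(2)]) blast
  show ?thesis unfolding finite_blaschke_product_def
    by (rule exI[of _ "Suc n"], rule exI[of _ "b(n := a)"])
       (use assms(1) b in \<open>auto simp: less_Suc_eq mult.commute\<close>)
qed

lemma finite_blaschke_product_mult_power:
  assumes "norm a < 1" "finite_blaschke_product B"
  shows "finite_blaschke_product (\<lambda>z. blaschke_factor a z ^ k * B z)"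
proof (induction k)
  case (Suc k)
  from finite_blaschke_product_mult_factor[OF assms(1) this] show ?case by (simp add: mult.assoc)
qed (simp add: assms)

lemma finite_blaschke_product_regular:
  assumes "finite_blaschke_product B"
  shows "continuous_on (cball 0 1) B" "B holomorphic_on ball 0 1"
    "\<And>z. norm z = 1 \<Longrightarrow> norm (B z) = 1"
proof -
  obtain n :: nat and b where b: "\<And>j. j < n \<Longrightarrow> norm (b j) < 1"
    and B: "\<And>z. norm z \<le> 1 \<Longrightarrow> B z = (\<Prod>j<n. blaschke_factor (b j) z)"
    by (rule finite_blaschke_productE[OF assms]) blast
  have "continuous_on (cball 0 1) (\<lambda>z. \<Prod>j<n. blaschke_factor (b j) z)"
    using b by (intro continuous_intros continuous_on_blaschke_factor) auto
  then show "continuous_on (cball 0 1) B"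
    by (rule continuous_on_eq) (simp add: B)
  have "(\<lambda>z. \<Prod>j<n. blaschke_factor (b j) z) holomorphic_on ball 0 1"
    using b by (intro holomorphic_intros holomorphic_on_blaschke_factor) auto
  then show "B holomorphic_on ball 0 1"
    by (rule holomorphic_transform) (simp add: B)
  show "norm (B z) = 1" if "norm z = 1" for z
    using that b by (simp add: B norm_blaschke_factor_circle flip: prod_norm)
qed

lemma finite_blaschke_product_has_zero:
  assumes "finite_blaschke_product B" "\<not> B constant_on ball 0 1"
  shows "\<exists>z\<in>ball 0 1. B z = 0"
proof -
  obtain n :: nat and b where b: "\<And>j. j < n \<Longrightarrow> norm (b j) < 1"
    and B: "\<And>z. norm z \<le> 1 \<Longrightarrow> B z = (\<Prod>j<n. blaschke_factor (b j) z)"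
    by (rule finite_blaschke_productE[OF assms(1)]) blast
  have "n \<noteq> 0"
  proof
    assume "n = 0"
    then have "B constant_on ball 0 1" unfolding constant_on_def by (intro exI[of _ 1]) (simp add: B)
    with assms(2) show False by simp
  qed
  then have "blaschke_factor (b 0) (b 0) = 0" "norm (b 0) \<le> 1"
    using b[of 0] by (simp_all add: blaschke_factor_eq_0_iff less_imp_le)
  then have "B (b 0) = 0"
    using \<open>n \<noteq> 0\<close> unfolding B[OF \<open>norm (b 0) \<le> 1\<close>]
    by (intro prod_zero bexI[of _ 0]) auto
  then show ?thesis using b[of 0] \<open>n \<noteq> 0\<close> by (intro bexI[of _ "b 0"]) auto
qed

text \<open>The zeros stay away from the circle, so they are finitely many, and the induction is on their number. A
zero \<open>a\<close> of order \<open>k\<close> is removed by dividing by the \<open>k\<close>-th power of the Blaschke factor at \<open>a\<close>; the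
quotient still has modulus tending to one because the factor itself does.\<close>

lemma unimodular_boundary_imp_finite_blaschke_product:
  assumes "g holomorphic_on ball 0 1" "((\<lambda>z. norm (g z)) \<longlongrightarrow> 1) boundary_filter"
  shows "\<exists>c B. norm c = 1 \<and> finite_blaschke_product B \<and> (\<forall>z\<in>ball 0 1. g z = c * B z)"
  using assms
proof (induction "card {z \<in> ball 0 1. g z = 0}" arbitrary: g rule: less_induct)
  case less
  note g = less.prems(1) and lim = less.prems(2)
  show ?case
  proof (cases "\<exists>a\<in>ball 0 1. g a = 0")
    case False
    then obtain c where "norm c = 1" "\<And>z. norm z < 1 \<Longrightarrow> g z = c"
      using zero_free_unimodular_boundary_imp_const[OF g lim] by (metis mem_ball_0)
    then show ?thesis by (intro exI[of _ c] exI[of _ "\<lambda>_. 1"]) (auto simp: finite_blaschke_product_one)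
  next
    case True
    then obtain a where a: "norm a < 1" "g a = 0" by auto
    have "eventually (\<lambda>z. 1 / 2 < norm (g z)) boundary_filter"
      by (intro order_tendstoD(1)[OF lim]) auto
    then obtain r where r: "r < 1" "\<And>w. r < norm w \<Longrightarrow> norm w < 1 \<Longrightarrow> 1 / 2 < norm (g w)"
      unfolding eventually_boundary_filter by auto
    have nc: "\<not> g constant_on ball 0 1"
      by (rule zero_unimodular_boundary_imp_nonconstant[OF lim a])
    have fin: "finite {z \<in> ball 0 1. g z = 0}"
    proof (rule finite_subset)
      show "finite {z \<in> cball 0 r. g z = 0}"
        using r(1) by (intro holomorphic_compact_finite_zeros[OF g _ _ _ _ nc]) auto
      show "{z \<in> ball 0 1. g z = 0} \<subseteq> {z \<in> cball 0 r. g z = 0}"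
        using r(2) by (force simp: not_less[symmetric])
    qed
    obtain h0 \<rho> k where k: "0 < k" and \<rho>: "0 < \<rho>" "ball a \<rho> \<subseteq> ball 0 1"
      and h0: "h0 holomorphic_on ball a \<rho>" "\<And>w. w \<in> ball a \<rho> \<Longrightarrow> g w = (w - a) ^ k * h0 w"
        "\<And>w. w \<in> ball a \<rho> \<Longrightarrow> h0 w \<noteq> 0"
      by (rule holomorphic_factor_zero_nonconstant[OF g open_ball connected_ball _ a(2) nc])
         (use a(1) in simp, blast)
    define e where "e = (if a = 0 then -1 else of_real (norm a) / a)"
    have e: "e \<noteq> 0" by (auto simp: e_def)
    define q where "q w = - (1 - cnj a * w) / e" for w
    have q: "w - a = blaschke_factor a w * q w" "q w \<noteq> 0" if "norm w < 1" for w
    proof -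
      define D where "D = 1 - cnj a * w"
      have D: "D \<noteq> 0" using blaschke_denominator_nonzero[OF a(1), of w] that by (auto simp: D_def)
      have q': "q w = - D / e" by (simp add: q_def D_def)
      have "blaschke_factor a w = e * ((a - w) / D)" by (simp only: blaschke_factor_def e_def D_def)
      then have "blaschke_factor a w * q w = e * ((a - w) / D) * (- D / e)" by (simp only: q')
      also have "\<dots> = w - a" using e D by (simp add: field_simps)
      finally show "w - a = blaschke_factor a w * q w" by simp
      show "q w \<noteq> 0" using D e by (simp add: q')
    qed
    \<comment> \<open>The quotient \<open>g / blaschke_factor a ^ k\<close>, whose value at the removable singularity \<open>a\<close> comes
      from \<open>g w = (w - a) ^ k * h0 w\<close> and \<open>w - a = blaschke_factor a w * q w\<close>.\<close>
    define h where "h w = (if w = a then h0 a * q a ^ k else g w / blaschke_factor a w ^ k)" for w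
    have bf0: "blaschke_factor a w = 0 \<longleftrightarrow> w = a" if "norm w < 1" for w
      using blaschke_factor_eq_0_iff[OF a(1)] that by auto
    have "h holomorphic_on (ball 0 1 - {a}) \<union> ball a \<rho>"
    proof (rule holomorphic_on_Un)
      have "(\<lambda>w. g w / blaschke_factor a w ^ k) holomorphic_on ball 0 1 - {a}"
        using a(1) bf0
        by (intro holomorphic_intros holomorphic_on_subset[OF g]
              holomorphic_on_subset[OF holomorphic_on_blaschke_factor]) auto
      then show "h holomorphic_on ball 0 1 - {a}"
        by (rule holomorphic_transform) (auto simp: h_def)
      have "(\<lambda>w. h0 w * q w ^ k) holomorphic_on ball a \<rho>"
        unfolding q_def using e by (intro holomorphic_intros h0) auto
      then show "h holomorphic_on ball a \<rho>"
      proof (rule holomorphic_transform)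
        fix w assume w: "w \<in> ball a \<rho>"
        then have n: "norm w < 1" using \<rho> by auto
        show "h0 w * q w ^ k = h w"
          using h0(2)[OF w] q(1)[OF n] bf0[OF n] by (auto simp: h_def power_mult_distrib)
      qed
    qed auto
    moreover have "(ball 0 1 - {a}) \<union> ball a \<rho> = ball 0 1" using \<rho> a(1) by auto
    ultimately have hh: "h holomorphic_on ball 0 1" by simp
    have "((\<lambda>z. norm (g z) / norm (blaschke_factor a z) ^ k) \<longlongrightarrow> 1 / 1 ^ k) boundary_filter"
      using a(1) by (intro tendsto_intros lim norm_tends_to_1_at_boundary
          continuous_on_blaschke_factor norm_blaschke_factor_circle) auto
    moreover have "eventually (\<lambda>z. norm (g z) / norm (blaschke_factor a z) ^ k = norm (h z)) boundary_filter"
      unfolding eventually_boundary_filter using a(1)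
      by (intro exI[of _ "norm a"]) (auto simp: h_def norm_divide norm_power)
    ultimately have hl: "((\<lambda>z. norm (h z)) \<longlongrightarrow> 1) boundary_filter"
      by (simp add: tendsto_cong)
    have "{z \<in> ball 0 1. h z = 0} \<subset> {z \<in> ball 0 1. g z = 0}"
    proof -
      have "h a \<noteq> 0" using h0(3)[of a] \<rho> q(2)[of a] a by (simp add: h_def)
      moreover have "g z = 0" if "norm z < 1" "h z = 0" "z \<noteq> a" for z
        using that bf0[of z] by (auto simp: h_def)
      ultimately show ?thesis using a by auto
    qed
    then have "card {z \<in> ball 0 1. h z = 0} < card {z \<in> ball 0 1. g z = 0}"
      by (rule psubset_card_mono[OF fin])
    from less.hyps[OF this hh hl] obtain c B where
      cB: "norm c = 1" "finite_blaschke_product B" "\<forall>z\<in>ball 0 1. h z = c * B z" by auto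
    show ?thesis
    proof (intro exI conjI ballI)
      show "norm c = 1" by fact
      show "finite_blaschke_product (\<lambda>z. blaschke_factor a z ^ k * B z)"
        by (rule finite_blaschke_product_mult_power[OF a(1) cB(2)])
      fix z :: complex assume z: "z \<in> ball 0 1"
      then have "g z = blaschke_factor a z ^ k * h z"
        using bf0[of z] a k by (cases "z = a") (auto simp: h_def)
      then show "g z = c * (blaschke_factor a z ^ k * B z)" using cB(3) z by simp
    qed
  qed
qed

section \<open>Garsia norm and extremal functions\<close>

lemma Linf_E:
  assumes "f \<in> Linf"
  obtains M where "0 \<le> M" "f \<in> borel_measurable circle_measure"
    "AE \<zeta> in circle_measure. norm (f \<zeta>) \<le> M" "Linf_norm f = ereal M"
proof -
  have f [measurable]: "f \<in> borel_measurable circle_measure" and fin: "Linf_norm f < \<infinity>"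
    using assms by (auto simp: Linf_def)
  have "esssup circle_measure (\<lambda>_. 0::ereal) \<le> Linf_norm f"
    unfolding Linf_norm_def by (rule esssup_mono) auto
  then have "0 \<le> Linf_norm f"
    by (simp add: esssup_circle_const)
  with fin obtain M where M: "Linf_norm f = ereal M" "0 \<le> M"
    by (cases "Linf_norm f") auto
  have "AE \<zeta> in circle_measure. ereal (norm (f \<zeta>)) \<le> Linf_norm f"
    unfolding Linf_norm_def by (rule esssup_AE)
  then have "AE \<zeta> in circle_measure. norm (f \<zeta>) \<le> M" by (simp add: M)
  with M f that show thesis by blast
qed

lemma Linf_norm_AE_const:
  assumes [measurable]: "f \<in> borel_measurable circle_measure" and "AE \<zeta> in circle_measure. norm (f \<zeta>) = M"
  shows "Linf_norm f = ereal M" "f \<in> Linf"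
proof -
  have "Linf_norm f = esssup circle_measure (\<lambda>_. ereal M)"
    unfolding Linf_norm_def by (rule esssup_AE_cong) (use assms(2) in auto)
  then show "Linf_norm f = ereal M" by (simp add: esssup_circle_const)
  then show "f \<in> Linf" by (simp add: Linf_def)
qed

lemma bounded_in_L2:
  assumes [measurable]: "f \<in> borel_measurable circle_measure" and "AE \<zeta> in circle_measure. norm (f \<zeta>) \<le> M"
  shows "f \<in> L2"
proof -
  have "AE \<zeta> in circle_measure. norm ((norm (f \<zeta>))\<^sup>2) \<le> M\<^sup>2"
    using assms(2) by eventually_elim (simp add: power_mono)
  then show ?thesis by (auto simp: L2_def intro!: integrable_bounded_circle)
qed

lemma garsia_Phi_le:
  assumes [measurable]: "f \<in> borel_measurable circle_measure" and "AE \<zeta> in circle_measure. norm (f \<zeta>) \<le> M"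
    and "norm z < 1"
  shows "garsia_Phi f z \<le> M\<^sup>2"
proof -
  have "AE \<zeta> in circle_measure. norm ((norm (f \<zeta>))\<^sup>2) \<le> M\<^sup>2"
    using assms(2) by eventually_elim (simp add: power_mono)
  then have "poisson (\<lambda>\<zeta>. (norm (f \<zeta>))\<^sup>2) z \<le> M\<^sup>2"
    using assms(3) by (intro poisson_le) measurable
  moreover have "0 \<le> (norm (poisson f z))\<^sup>2" by simp
  ultimately show ?thesis unfolding garsia_Phi_def by linarith
qed

text \<open>Both inequalities in \<open>\<Phi>\<^sub>f(z) \<le> P(|f|\<^sup>2)(z) \<le> M\<^sup>2\<close> are equalities; the first gives \<open>Pf(z) = 0\<close> and
the second \<open>|f| = M\<close>.\<close>

lemma garsia_Phi_maximal_imp: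
  assumes f [measurable]: "f \<in> borel_measurable circle_measure" and le: "AE \<zeta> in circle_measure. norm (f \<zeta>) \<le> M"
    and z: "norm z < 1" and M: "0 \<le> M" and eq: "garsia_Phi f z = M\<^sup>2"
  shows "poisson f z = 0" "AE \<zeta> in circle_measure. norm (f \<zeta>) = M"
proof -
  have sq: "AE \<zeta> in circle_measure. norm ((norm (f \<zeta>))\<^sup>2) \<le> M\<^sup>2"
    using le by eventually_elim (simp add: power_mono)
  then have "poisson (\<lambda>\<zeta>. (norm (f \<zeta>))\<^sup>2) z \<le> M\<^sup>2"
    using z by (intro poisson_le) measurable
  moreover have "0 \<le> (norm (poisson f z))\<^sup>2" by simp
  ultimately have p: "(norm (poisson f z))\<^sup>2 = 0" "poisson (\<lambda>\<zeta>. (norm (f \<zeta>))\<^sup>2) z = M\<^sup>2"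
    using eq unfolding garsia_Phi_def by linarith+
  then show "poisson f z = 0" by simp
  have "AE \<zeta> in circle_measure. (norm (f \<zeta>))\<^sup>2 = M\<^sup>2"
    by (rule poisson_attains_bound_imp_AE_eq[OF _ sq z p(2)]) measurable
  then show "AE \<zeta> in circle_measure. norm (f \<zeta>) = M"
    by eventually_elim (use M in simp)
qed

lemma garsia_Phi_unimodular:
  assumes [measurable]: "f \<in> borel_measurable circle_measure" and "AE \<zeta> in circle_measure. norm (f \<zeta>) = M"
    and z: "norm z < 1"
  shows "garsia_Phi f z = M\<^sup>2 - (norm (poisson f z))\<^sup>2"
proof -
  have "poisson (\<lambda>\<zeta>. (norm (f \<zeta>))\<^sup>2) z = poisson (\<lambda>_. M\<^sup>2) z"
    by (rule poisson_cong_AE[OF _ _ z]) (use assms(2) in auto)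
  then show ?thesis by (simp add: garsia_Phi_def poisson_const_real[OF z])
qed

lemma garsia_norm_attained:
  assumes "z0 \<in> ball 0 1" "\<And>z. z \<in> ball 0 1 \<Longrightarrow> garsia_Phi f z \<le> garsia_Phi f z0"
  shows "garsia_norm f = ereal (sqrt (garsia_Phi f z0))"
  unfolding garsia_norm_def using assms
  by (intro antisym SUP_least SUP_upper2[of z0]) auto

text \<open>At the zero of \<open>Pf\<close> the function \<open>\<Phi>\<^sub>f = M\<^sup>2 - |Pf|\<^sup>2\<close> reaches its upper bound \<open>M\<^sup>2\<close>.\<close>

lemma unimodular_with_zero_extremal:
  assumes f: "f \<in> borel_measurable circle_measure" and eq: "AE \<zeta> in circle_measure. norm (f \<zeta>) = M"
    and z0: "norm z0 < 1" "poisson f z0 = 0" and M: "0 \<le> M"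
  shows "G_extremal f" "f \<in> BMO_na"
proof -
  have le: "AE \<zeta> in circle_measure. norm (f \<zeta>) \<le> M" using eq by eventually_elim simp
  have P: "garsia_Phi f z0 = M\<^sup>2" using garsia_Phi_unimodular[OF f eq z0(1)] z0(2) by simp
  have "garsia_norm f = ereal (sqrt (garsia_Phi f z0))"
    using z0(1) garsia_Phi_le[OF f le] by (intro garsia_norm_attained) (auto simp: P)
  then have g: "garsia_norm f = ereal M" using M by (simp add: P)
  then show "G_extremal f"
    using Linf_norm_AE_const[OF f eq] by (simp add: G_extremal_def)
  have "f \<in> BMO" using g bounded_in_L2[OF f le] by (simp add: BMO_def)
  then show "f \<in> BMO_na" using g P z0(1) by (auto simp: BMO_na_def intro!: bexI[of _ z0])
qed

text \<open>A continuous function on the disc that is positive somewhere and vanishes at the boundary attains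
its supremum. Boundedness of \<open>f\<close> serves for the continuity of \<open>\<Phi>\<^sub>f\<close>.\<close>

lemma bounded_VMO_attains_garsia_norm:
  assumes f: "f \<in> borel_measurable circle_measure" "AE \<zeta> in circle_measure. norm (f \<zeta>) \<le> M"
    and VMO: "f \<in> VMO" and pos: "garsia_norm f > 0"
  shows "f \<in> BMO_na"
proof -
  note [measurable] = f(1)
  have "AE \<zeta> in circle_measure. norm ((norm (f \<zeta>))\<^sup>2) \<le> M\<^sup>2"
    using f(2) by eventually_elim (simp add: power_mono)
  then have cont: "continuous_on (ball 0 1) (garsia_Phi f)"
    unfolding garsia_Phi_def by (intro continuous_intros continuous_on_poisson[OF f] continuous_on_poisson) measurable
  have lim: "(garsia_Phi f \<longlongrightarrow> 0) boundary_filter" and BMO: "f \<in> BMO"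
    using VMO by (auto simp: VMO_def)
  obtain z1 where z1: "z1 \<in> ball 0 1" "garsia_Phi f z1 > 0"
    using pos unfolding garsia_norm_def less_SUP_iff by (auto simp: less_ereal.simps)
  obtain r where r: "r < 1" "\<And>z. r < norm z \<Longrightarrow> norm z < 1 \<Longrightarrow> garsia_Phi f z < garsia_Phi f z1"
    using order_tendstoD(2)[OF lim z1(2)] unfolding eventually_boundary_filter by auto
  have z1r: "z1 \<in> cball 0 r" using r(2)[of z1] z1(1) by force
  have "\<exists>z0\<in>cball 0 r. \<forall>z\<in>cball 0 r. garsia_Phi f z \<le> garsia_Phi f z0"
    using z1r r(1) continuous_on_subset[OF cont, of "cball 0 r"]
    by (intro continuous_attains_sup[of "cball 0 r" "garsia_Phi f"]) fastforce+
  then obtain z0 where z0: "z0 \<in> cball 0 r" "\<And>z. z \<in> cball 0 r \<Longrightarrow> garsia_Phi f z \<le> garsia_Phi f z0"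
    by blast
  have z0b: "z0 \<in> ball 0 1" using z0(1) r(1) by auto
  have "garsia_Phi f z \<le> garsia_Phi f z0" if "z \<in> ball 0 1" for z
  proof (cases "norm z \<le> r")
    case True
    then show ?thesis by (intro z0) auto
  next
    case False
    then have "garsia_Phi f z < garsia_Phi f z1" using that by (intro r) auto
    also have "\<dots> \<le> garsia_Phi f z0" by (intro z0 z1r)
    finally show ?thesis by simp
  qed
  then have "garsia_norm f = ereal (sqrt (garsia_Phi f z0))"
    by (intro garsia_norm_attained z0b)
  moreover have "garsia_Phi f z0 > 0" using z0(2)[OF z1r] z1(2) by simp
  ultimately show ?thesis using BMO z0b by (auto simp: BMO_na_def)
qed

lemma inner_function_of_unimodular_boundary:
  assumes gc: "continuous_on (cball 0 1) g" and gh: "g holomorphic_on ball 0 1"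
    and g1: "\<And>z. norm z = 1 \<Longrightarrow> norm (g z) = 1"
  shows "inner_function g"
proof -
  have m: "g \<in> borel_measurable circle_measure"
    by (intro continuous_measurable_circle continuous_on_subset[OF gc]) auto
  have 1: "AE \<zeta> in circle_measure. norm (g \<zeta>) = 1"
    using AE_norm_eq_1 by eventually_elim (rule g1)
  have "poisson g holomorphic_on ball 0 1"
    by (rule holomorphic_transform[OF gh]) (simp add: poisson_holomorphic[OF gc gh])
  then show ?thesis
    using Linf_norm_AE_const(2)[OF m 1] 1 by (simp add: inner_function_def Hinf_def analytic_on_open)
qed

lemma AE_eq_mult_inner:
  assumes I: "inner_function I" and eq: "AE \<zeta> in circle_measure. f \<zeta> = c * I \<zeta>"
  shows "f \<in> borel_measurable circle_measure" "AE \<zeta> in circle_measure. norm (f \<zeta>) = norm c"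
    "\<And>z. norm z < 1 \<Longrightarrow> poisson f z = c * poisson I z"
proof -
  have I': "I \<in> borel_measurable circle_measure" "AE \<zeta> in circle_measure. norm (I \<zeta>) = 1"
    using I by (auto simp: inner_function_def Hinf_def Linf_def)
  note [measurable] = I'(1)
  show f: "f \<in> borel_measurable circle_measure"
    by (rule measurable_circle_AE_cong[of "\<lambda>\<zeta>. c * I \<zeta>"]) (measurable, use eq in eventually_elim, simp)
  show "AE \<zeta> in circle_measure. norm (f \<zeta>) = norm c"
    using eq I'(2) by eventually_elim (simp add: norm_mult)
  show "poisson f z = c * poisson I z" if "norm z < 1" for z
    using poisson_cong_AE[OF f eq that] by (simp add: poisson_mult_left)
qed

text \<open>For an extremal \<open>f\<close> take \<open>c = \<parallel>f\<parallel>\<^sub>\<infinity>\<close>. If this is zero then \<open>f\<close> vanishes almost everywhere and the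
inner function is arbitrary; the identity function is chosen.\<close>

theorem attained_extremal_iff_multiple_of_inner:
  "G_extremal f \<and> f \<in> BMO_na \<inter> Hinf \<longleftrightarrow>
     (\<exists>c I. inner_function I \<and> (\<exists>z\<in>ball 0 1. poisson I z = 0) \<and>
            (AE \<zeta> in circle_measure. f \<zeta> = c * I \<zeta>))" (is "?L \<longleftrightarrow> ?R")
proof
  assume L: ?L
  then obtain M where M: "0 \<le> M" "f \<in> borel_measurable circle_measure"
    "AE \<zeta> in circle_measure. norm (f \<zeta>) \<le> M" "Linf_norm f = ereal M"
    using Linf_E[of f] by (auto simp: G_extremal_def)
  obtain z0 where z0: "norm z0 < 1" "(garsia_norm f)\<^sup>2 = ereal (garsia_Phi f z0)"
    using L by (auto simp: BMO_na_def)
  have P: "garsia_Phi f z0 = M\<^sup>2"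
    using z0(2) L M(4) by (simp add: G_extremal_def)
  note max = garsia_Phi_maximal_imp[OF M(2,3) z0(1) M(1) P]
  show ?R
  proof (cases "M = 0")
    case True
    have id: "inner_function (\<lambda>z. z)"
      by (rule inner_function_of_unimodular_boundary) auto
    have "poisson (\<lambda>z. z) 0 = (0::complex)"
      by (rule poisson_holomorphic) auto
    then show ?thesis using max(2) id True
      by (intro exI[of _ 0] exI[of _ "\<lambda>z. z"]) (auto intro!: bexI[of _ 0])
  next
    case False
    define I where "I \<zeta> = inverse (of_real M) * f \<zeta>" for \<zeta>
    have PI: "poisson I z = inverse (of_real M) * poisson f z" for z
      unfolding I_def by (rule poisson_mult_left)
    have "poisson f holomorphic_on ball 0 1"
      using L by (simp add: Hinf_def analytic_on_open)
    then have hol: "poisson I holomorphic_on ball 0 1"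
      unfolding PI[abs_def] by (intro holomorphic_intros)
    have I1: "AE \<zeta> in circle_measure. norm (I \<zeta>) = 1"
      using max(2) by eventually_elim (use False M(1) in \<open>simp add: I_def norm_mult norm_inverse\<close>)
    have "I \<in> borel_measurable circle_measure"
      unfolding I_def using M(2) by measurable
    then have "inner_function I"
      using Linf_norm_AE_const(2)[OF _ I1] I1 hol by (simp add: inner_function_def Hinf_def analytic_on_open)
    moreover have "poisson I z0 = 0" by (simp add: PI max(1))
    moreover have "AE \<zeta> in circle_measure. f \<zeta> = of_real M * I \<zeta>"
      using False by (simp add: I_def)
    ultimately show ?thesis using z0(1) by (intro exI[of _ "of_real M"] exI[of _ I]) auto
  qed
next
  assume ?R
  then obtain c I z0 where I: "inner_function I" and z0: "norm z0 < 1" "poisson I z0 = 0"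
    and eq: "AE \<zeta> in circle_measure. f \<zeta> = c * I \<zeta>" by auto
  note f = AE_eq_mult_inner[OF I eq]
  have "poisson I holomorphic_on ball 0 1"
    using I by (simp add: inner_function_def Hinf_def analytic_on_open)
  then have "(\<lambda>z. c * poisson I z) holomorphic_on ball 0 1" by (intro holomorphic_intros)
  then have "poisson f holomorphic_on ball 0 1"
    by (rule holomorphic_transform) (simp add: f(3))
  then have "f \<in> Hinf"
    using Linf_norm_AE_const(2)[OF f(1,2)] by (simp add: Hinf_def analytic_on_open)
  then show ?L
    using unimodular_with_zero_extremal[OF f(1,2) z0(1)] z0(2) f(3)[OF z0(1)] by simp
qed

text \<open>The boundary limit \<open>\<Phi>\<^sub>f \<longlongrightarrow> 0\<close> and the boundary limit \<open>|PI| \<longlongrightarrow> 1\<close> are equivalent through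
\<open>\<Phi>\<^sub>f = |c|\<^sup>2(1 - |PI|\<^sup>2)\<close>, which holds for \<open>f = cI\<close> with \<open>I\<close> inner, as long as \<open>c\<close> is not zero; the zero function
needs only some nonconstant Blaschke product as a partner. The unimodular constant left
over in the Blaschke factorization of \<open>PI\<close> is absorbed into the scalar.\<close>

theorem extremal_QA_iff_multiple_of_finite_blaschke_product:
  "G_extremal f \<and> f \<in> QA \<longleftrightarrow>
     (\<exists>c B. finite_blaschke_product B \<and> \<not> B constant_on ball 0 1 \<and>
            (AE \<zeta> in circle_measure. f \<zeta> = c * B \<zeta>))" (is "?L \<longleftrightarrow> ?R")
proof
  assume L: ?L
  then obtain M where M: "0 \<le> M" "f \<in> borel_measurable circle_measure"
    "AE \<zeta> in circle_measure. norm (f \<zeta>) \<le> M" "Linf_norm f = ereal M"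
    using Linf_E[of f] by (auto simp: G_extremal_def)
  show ?R
  proof (cases "M = 0")
    case True
    \<comment> \<open>The Blaschke factor at the origin is the identity function, because of the convention
      \<open>|a| / a = -1\<close> there.\<close>
    have "finite_blaschke_product (\<lambda>z. blaschke_factor 0 z * 1)"
      by (intro finite_blaschke_product_mult_factor finite_blaschke_product_one) simp
    then have B: "finite_blaschke_product (\<lambda>z. z)" by (simp add: blaschke_factor_def)
    have nc: "\<not> (\<lambda>z::complex. z) constant_on ball 0 1"
      by (rule zero_unimodular_boundary_imp_nonconstant[of _ 0] norm_tends_to_1_at_boundary)+ auto
    have "AE \<zeta> in circle_measure. f \<zeta> = 0 * \<zeta>"
      using M(3) by eventually_elim (simp add: True)
    with B nc show ?thesis by blast
  next
    case False
    have "f \<in> BMO_na"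
    proof (rule bounded_VMO_attains_garsia_norm[OF M(2,3)])
      show "f \<in> VMO" using L by (simp add: QA_def)
      show "garsia_norm f > 0" using L M(1,4) False by (simp add: G_extremal_def)
    qed
    with L attained_extremal_iff_multiple_of_inner[of f] obtain c I z0
      where I: "inner_function I" and z0: "norm z0 < 1" "poisson I z0 = 0"
      and eq: "AE \<zeta> in circle_measure. f \<zeta> = c * I \<zeta>" by (auto simp: QA_def)
    note f = AE_eq_mult_inner[OF I eq]
    have c: "norm c = M" using Linf_norm_AE_const(1)[OF f(1,2)] M(4) by simp
    have Im: "I \<in> borel_measurable circle_measure" "AE \<zeta> in circle_measure. norm (I \<zeta>) = 1"
      and g: "poisson I holomorphic_on ball 0 1"
      using I by (auto simp: inner_function_def Hinf_def Linf_def analytic_on_open)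
    have "((\<lambda>z. sqrt (1 - garsia_Phi f z / M\<^sup>2)) \<longlongrightarrow> sqrt (1 - 0 / M\<^sup>2)) boundary_filter"
      using L by (intro tendsto_intros) (auto simp: QA_def VMO_def False)
    moreover have "eventually (\<lambda>z. sqrt (1 - garsia_Phi f z / M\<^sup>2) = norm (poisson I z)) boundary_filter"
      unfolding eventually_boundary_filter
    proof (intro exI[of _ 0] conjI allI impI)
      fix z :: complex assume "0 < norm z \<and> norm z < 1"
      then have z: "norm z < 1" by simp
      have "garsia_Phi f z = M\<^sup>2 * (1 - (norm (poisson I z))\<^sup>2)"
        unfolding garsia_Phi_unimodular[OF f(1,2) z] f(3)[OF z] c norm_mult by (simp add: algebra_simps power_mult_distrib)
      then show "sqrt (1 - garsia_Phi f z / M\<^sup>2) = norm (poisson I z)" using False by simp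
    qed simp
    ultimately have lim: "((\<lambda>z. norm (poisson I z)) \<longlongrightarrow> 1) boundary_filter"
      by (simp add: tendsto_cong)
    obtain d B where d: "norm d = 1" and B: "finite_blaschke_product B"
      and PI: "\<And>z. norm z < 1 \<Longrightarrow> poisson I z = d * B z"
      using unimodular_boundary_imp_finite_blaschke_product[OF g lim] by auto
    note B' = finite_blaschke_product_regular[OF B]
    have "AE \<zeta> in circle_measure. I \<zeta> = d * B \<zeta>"
    proof (rule boundary_values_unique[OF Im(1)])
      show "AE \<zeta> in circle_measure. norm (I \<zeta>) \<le> norm (d * B \<zeta>)"
        using Im(2) AE_norm_eq_1 by eventually_elim (simp add: norm_mult d B'(3))
    qed (use B' in \<open>auto intro!: continuous_intros holomorphic_intros simp: PI\<close>)
    with eq have "AE \<zeta> in circle_measure. f \<zeta> = (c * d) * B \<zeta>"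
      by eventually_elim simp
    moreover have "B z0 = 0" using PI[OF z0(1)] z0(2) d by auto
    then have "\<not> B constant_on ball 0 1"
      by (intro zero_unimodular_boundary_imp_nonconstant[OF norm_tends_to_1_at_boundary[OF B'(1,3)] z0(1)])
    ultimately show ?thesis using B by blast
  qed
next
  assume ?R
  then obtain c B where B: "finite_blaschke_product B" "\<not> B constant_on ball 0 1"
    and eq: "AE \<zeta> in circle_measure. f \<zeta> = c * B \<zeta>" by auto
  note B' = finite_blaschke_product_regular[OF B(1)]
  have I: "inner_function B" by (rule inner_function_of_unimodular_boundary[OF B'])
  note PB = poisson_holomorphic[OF B'(1,2)]
  have "\<exists>z\<in>ball 0 1. poisson B z = 0"
    using finite_blaschke_product_has_zero[OF B] by (auto simp: PB)
  with I eq attained_extremal_iff_multiple_of_inner[of f]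
  have *: "G_extremal f" "f \<in> BMO" "f \<in> Hinf" by (auto simp: BMO_na_def)
  note f = AE_eq_mult_inner[OF I eq]
  have "((\<lambda>z. (norm c)\<^sup>2 * (1 - (norm (B z))\<^sup>2)) \<longlongrightarrow> (norm c)\<^sup>2 * (1 - 1\<^sup>2)) boundary_filter"
    by (intro tendsto_intros norm_tends_to_1_at_boundary B')
  moreover have "eventually (\<lambda>z. (norm c)\<^sup>2 * (1 - (norm (B z))\<^sup>2) = garsia_Phi f z) boundary_filter"
    unfolding eventually_boundary_filter
  proof (intro exI[of _ 0] conjI allI impI)
    fix z :: complex assume "0 < norm z \<and> norm z < 1"
    then have z: "norm z < 1" by simp
    show "(norm c)\<^sup>2 * (1 - (norm (B z))\<^sup>2) = garsia_Phi f z"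
      unfolding garsia_Phi_unimodular[OF f(1,2) z] f(3)[OF z] PB[OF z] norm_mult
      by (simp add: algebra_simps power_mult_distrib)
  qed simp
  ultimately have "(garsia_Phi f \<longlongrightarrow> 0) boundary_filter"
    by (simp add: tendsto_cong)
  with * show ?L by (simp add: QA_def VMO_def)
qed

theorem corollary2p2:
  fixes f :: "complex \<Rightarrow> complex"
  shows "(G_extremal f \<and> f \<in> BMO_na \<inter> Hinf \<longleftrightarrow>
            (\<exists>c I. inner_function I \<and> (\<exists>z\<in>ball 0 1. poisson I z = 0) \<and>
                   (AE \<zeta> in circle_measure. f \<zeta> = c * I \<zeta>)))
       \<and> (G_extremal f \<and> f \<in> QA \<longleftrightarrow>
            (\<exists>c B. finite_blaschke_product B \<and> \<not> B constant_on ball 0 1 \<and>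
                   (AE \<zeta> in circle_measure. f \<zeta> = c * B \<zeta>)))"
  using attained_extremal_iff_multiple_of_inner extremal_QA_iff_multiple_of_finite_blaschke_product
  by blast

end
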